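(* Let $(\varepsilon_n)_{n\ge1}$ be a sequence of independent random variables on a probability space $(\Omega,\mathcal A,\mathbb P)$, each taking the values $\pm1$ with probability $1/2$. Let $(d_n)_{n\ge0}$ be a sequence of real valued martingale differences on a probability space $(\Omega',\mathcal A',\mathbb P')$, i.e. there are $\sigma$-subalgebras $\mathcal A_n\subset\mathcal A'$ ($n\ge0$) forming an increasing filtration such that $d_n$ is $\mathcal A_n$-measurable for all $n\ge0$ and $\mathbb E^{\mathcal A_{n-1}}d_n=0$ for all $n\ge1$. Assume that $\mathcal A_0$ is trivial (so that $d_0$ is constant). If $|d_n|\le1$ a.s. for every $n$, then there is a linear operator $u:L_1(\Omega,\mathcal A,\mathbb P)\to L_1(\Omega',\mathcal A',\mathbb P')$ with $\|u\|=1$ such that $u(1)=1$ and $u(\varepsilon_n)=d_n$ for all $n\ge1$.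
   Context: $\mathbb E^{\mathcal B}$ denotes conditional expectation with respect to a $\sigma$-subalgebra $\mathcal B$. *)

theory Defs
  imports "HOL-Probability.Probability"
begin

text \<open>
  The space \<open>L\<^sub>1(M)\<close> consists of classes of integrable functions modulo equality almost
  everywhere. The codomain \<open>'k\<close> is the scalar field, to be instantiated by \<^typ>\<open>real\<close> or
  \<^typ>\<open>complex\<close>.
\<close>

definition L1_rel :: "'a measure \<Rightarrow>
    (('a \<Rightarrow> 'k::{real_normed_field,banach,second_countable_topology}) \<times> ('a \<Rightarrow> 'k)) set" where
  "L1_rel M = {(f, g). integrable M f \<and> integrable M g \<and> (AE x in M. f x = g x)}"

definition L1_class :: "'a measure \<Rightarrow>
    ('a \<Rightarrow> 'k::{real_normed_field,banach,second_countable_topology}) \<Rightarrow> ('a \<Rightarrow> 'k) set" where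
  "L1_class M f = L1_rel M `` {f}"

definition L1_space :: "'a measure \<Rightarrow>
    ('a \<Rightarrow> 'k::{real_normed_field,banach,second_countable_topology}) set set" where
  "L1_space M = {f. integrable M f} // L1_rel M"

text \<open>
  The vector space operations and the norm are defined through a chosen representative; the
  lemmas below show that they do not depend on the choice.
\<close>

definition L1_rep :: "('a \<Rightarrow> 'k) set \<Rightarrow> 'a \<Rightarrow> 'k" where
  "L1_rep F = (SOME f. f \<in> F)"

definition L1_add :: "'a measure \<Rightarrow>
    ('a \<Rightarrow> 'k::{real_normed_field,banach,second_countable_topology}) set \<Rightarrow> ('a \<Rightarrow> 'k) set
      \<Rightarrow> ('a \<Rightarrow> 'k) set" where
  "L1_add M F G = L1_class M (\<lambda>x. L1_rep F x + L1_rep G x)"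

definition L1_scale :: "'a measure \<Rightarrow> 'k \<Rightarrow>
    ('a \<Rightarrow> 'k::{real_normed_field,banach,second_countable_topology}) set \<Rightarrow> ('a \<Rightarrow> 'k) set" where
  "L1_scale M c F = L1_class M (\<lambda>x. c * L1_rep F x)"

definition L1_norm :: "'a measure \<Rightarrow>
    ('a \<Rightarrow> 'k::{real_normed_field,banach,second_countable_topology}) set \<Rightarrow> real" where
  "L1_norm M F = (\<integral>x. norm (L1_rep F x) \<partial>M)"

definition L1_linear :: "'a measure \<Rightarrow> 'b measure \<Rightarrow>
    (('a \<Rightarrow> 'k::{real_normed_field,banach,second_countable_topology}) set \<Rightarrow> ('b \<Rightarrow> 'k) set)
      \<Rightarrow> bool" where
  "L1_linear M N u \<longleftrightarrow>
     u \<in> L1_space M \<rightarrow> L1_space N \<and>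
     (\<forall>F\<in>L1_space M. \<forall>G\<in>L1_space M. u (L1_add M F G) = L1_add N (u F) (u G)) \<and>
     (\<forall>c. \<forall>F\<in>L1_space M. u (L1_scale M c F) = L1_scale N c (u F))"

text \<open>
  The supremum is taken in \<^typ>\<open>ennreal\<close>, so that an unbounded operator has norm \<open>\<infinity>\<close>.
\<close>

definition L1_opnorm :: "'a measure \<Rightarrow> 'b measure \<Rightarrow>
    (('a \<Rightarrow> 'k::{real_normed_field,banach,second_countable_topology}) set \<Rightarrow> ('b \<Rightarrow> 'k) set)
      \<Rightarrow> ennreal" where
  "L1_opnorm M N u = (SUP F\<in>{F \<in> L1_space M. L1_norm M F \<le> 1}. ennreal (L1_norm N (u F)))"

lemma equiv_L1_rel: "equiv {f. integrable M f} (L1_rel M)"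
proof (rule equivI)
  show "L1_rel M \<subseteq> {f. integrable M f} \<times> {f. integrable M f}" "refl_on {f. integrable M f} (L1_rel M)"
    by (auto simp: L1_rel_def refl_on_def)
  show "sym (L1_rel M)"
    by (auto simp: L1_rel_def sym_def eq_commute)
  show "trans (L1_rel M)"
  proof (rule transI)
    fix f g h assume *: "(f, g) \<in> L1_rel M" "(g, h) \<in> L1_rel M"
    then have "AE x in M. f x = g x" "AE x in M. g x = h x" by (auto simp: L1_rel_def)
    then have "AE x in M. f x = h x" by eventually_elim simp
    with * show "(f, h) \<in> L1_rel M" by (auto simp: L1_rel_def)
  qed
qed

lemma L1_class_in_space: "integrable M f \<Longrightarrow> L1_class M f \<in> L1_space M"
  by (auto simp: L1_class_def L1_space_def intro: quotientI)

lemma L1_spaceE: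
  assumes "F \<in> L1_space M"
  obtains f where "integrable M f" "F = L1_class M f"
  using assms by (auto simp: L1_class_def L1_space_def elim: quotientE)

lemma L1_class_eq_iff:
  assumes "integrable M f" "integrable M g"
  shows "L1_class M f = L1_class M g \<longleftrightarrow> (AE x in M. f x = g x)"
  using eq_equiv_class_iff[OF equiv_L1_rel, of f M g] assms
  by (simp add: L1_class_def L1_rel_def)

lemma L1_rep_class:
  assumes "integrable M f"
  shows "integrable M (L1_rep (L1_class M f))" "AE x in M. L1_rep (L1_class M f) x = f x"
proof -
  have "f \<in> L1_class M f" using assms by (simp add: L1_class_def L1_rel_def)
  then have "L1_rep (L1_class M f) \<in> L1_class M f"
    unfolding L1_rep_def by (rule someI[where P = "\<lambda>g. g \<in> L1_class M f"])
  then show "integrable M (L1_rep (L1_class M f))" "AE x in M. L1_rep (L1_class M f) x = f x"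
    by (auto simp: L1_class_def L1_rel_def eq_commute)
qed

lemma L1_add_class:
  assumes f: "integrable M f" and g: "integrable M g"
  shows "L1_add M (L1_class M f) (L1_class M g) = L1_class M (\<lambda>x. f x + g x)"
proof -
  have "AE x in M. L1_rep (L1_class M f) x + L1_rep (L1_class M g) x = f x + g x"
    using L1_rep_class(2)[OF f] L1_rep_class(2)[OF g] by eventually_elim simp
  then show ?thesis
    unfolding L1_add_def using L1_rep_class(1)[OF f] L1_rep_class(1)[OF g] f g
    by (subst L1_class_eq_iff) auto
qed

lemma L1_scale_class:
  assumes f: "integrable M f"
  shows "L1_scale M c (L1_class M f) = L1_class M (\<lambda>x. c * f x)"
proof -
  have "AE x in M. c * L1_rep (L1_class M f) x = c * f x"
    using L1_rep_class(2)[OF f] by eventually_elim simp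
  then show ?thesis
    unfolding L1_scale_def using L1_rep_class(1)[OF f] f
    by (subst L1_class_eq_iff) auto
qed

lemma L1_norm_class:
  assumes f: "integrable M f"
  shows "L1_norm M (L1_class M f) = (\<integral>x. norm (f x) \<partial>M)"
  unfolding L1_norm_def
proof (rule integral_cong_AE)
  show "AE x in M. norm (L1_rep (L1_class M f) x) = norm (f x)"
    using L1_rep_class(2)[OF f] by eventually_elim simp
qed (use L1_rep_class(1)[OF f] f in auto)

end

theory Submission
  imports Defs
begin

text \<open>
  The idea is to realise \<open>d n\<close> as a conditional mean of random signs. Enlarge \<open>N\<close> by independent
  uniform variables and, given the point \<open>y\<close> of \<open>N\<close>, toss independent coins with values \<open>1\<close> and
  \<open>-1\<close> and means \<open>d n y\<close>, which is possible since \<open>|d n y| \<le> 1\<close> almost surely. Averaged over \<open>y\<close>,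
  these coins are independent and fair: the probability of a cylinder is the expectation of a
  product of factors \<open>a j + b j * d j y\<close>, and by the martingale property this is the product of
  the \<open>a j\<close> (\<open>martingale_difference_product\<close>, \<open>coins_law\<close>). So the coin sequence \<open>Y\<close> has the same
  law as the sequence \<open>X\<close> of the \<open>\<epsilon> n\<close>.

  Equality of laws produces the operator (\<open>operator_of_equal_laws\<close>). For \<open>f\<close> integrable on \<open>M\<close>
  write \<open>E[f | X] = g \<circ> X\<close>, pass to \<open>g \<circ> Y\<close>, and take the conditional expectation given \<open>y\<close>. Every
  step is linear, contractive and preserves \<open>1\<close>. Since \<open>\<epsilon> n\<close> is the \<open>n\<close>-th coordinate of \<open>X\<close>, it
  is sent to the conditional mean of the \<open>n\<close>-th coin, which is \<open>d n\<close>.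

  The construction is done for complex functions; the real operator is its real part.
\<close>

section \<open>From operators on functions to operators on classes\<close>

text \<open>
  Everything is required only for integrable functions and only almost everywhere, so that \<open>U\<close> may
  be built from arbitrary choices of representatives.
\<close>

definition L1_contraction :: "'a measure \<Rightarrow> 'b measure \<Rightarrow>
    (('a \<Rightarrow> 'k::{real_normed_field,banach,second_countable_topology}) \<Rightarrow> 'b \<Rightarrow> 'k) \<Rightarrow> bool" where
  "L1_contraction M N U \<longleftrightarrow>
     (\<forall>f. integrable M f \<longrightarrow> integrable N (U f)) \<and>
     (\<forall>f g. integrable M f \<longrightarrow> integrable M g \<longrightarrow> (AE y in N. U (\<lambda>x. f x + g x) y = U f y + U g y)) \<and>
     (\<forall>c f. integrable M f \<longrightarrow> (AE y in N. U (\<lambda>x. c * f x) y = c * U f y)) \<and>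
     (\<forall>f. integrable M f \<longrightarrow> (\<integral>y. norm (U f y) \<partial>N) \<le> (\<integral>x. norm (f x) \<partial>M))"

lemma L1_contractionD:
  assumes "L1_contraction M N U" and "integrable M f"
  shows "integrable N (U f)"
    and "integrable M g \<Longrightarrow> AE y in N. U (\<lambda>x. f x + g x) y = U f y + U g y"
    and "AE y in N. U (\<lambda>x. c * f x) y = c * U f y"
    and "(\<integral>y. norm (U f y) \<partial>N) \<le> (\<integral>x. norm (f x) \<partial>M)"
  using assms by (auto simp: L1_contraction_def)

text \<open>
  By contractivity \<open>U\<close> maps functions that agree almost everywhere to functions that agree almost
  everywhere, so it descends to classes. The constant \<open>1\<close>, of norm \<open>1\<close> on both sides, shows that
  the operator norm is attained.
\<close>

lemma L1_operator_of_functions: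
  fixes U :: "('a \<Rightarrow> 'k::{real_normed_field,banach,second_countable_topology}) \<Rightarrow> 'b \<Rightarrow> 'k"
  assumes "prob_space M" and "prob_space N"
    and U: "L1_contraction M N U" and one: "AE y in N. U (\<lambda>_. 1) y = 1"
  obtains u where "L1_linear M N u" and "L1_opnorm M N u = 1"
    and "\<forall>f. integrable M f \<longrightarrow> u (L1_class M f) = L1_class N (U f)"
proof -
  note int = L1_contractionD(1)[OF U] and add = L1_contractionD(2)[OF U]
    and scale = L1_contractionD(3)[OF U] and contr = L1_contractionD(4)[OF U]
  interpret M: prob_space M by fact
  interpret N: prob_space N by fact
  \<comment> \<open>\<open>U\<close> contracts \<open>f - g\<close>, which is null, to a null function.\<close>
  have cong: "AE y in N. U f y = U g y"
    if f: "integrable M f" and g: "integrable M g" and eq: "AE x in M. f x = g x" for f g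
  proof -
    let ?h = "\<lambda>x. f x + (- 1) * g x"
    have h: "integrable M ?h" using f g by (intro Bochner_Integration.integrable_add integrable_mult_right)
    have "(\<integral>x. norm (?h x) \<partial>M) = (\<integral>x. 0 \<partial>M)"
      using h eq by (intro integral_cong_AE) auto
    then have "(\<integral>y. norm (U ?h y) \<partial>N) = 0"
      using contr[OF h] by (intro antisym Bochner_Integration.integral_nonneg) simp_all
    then have "AE y in N. U ?h y = 0"
      using int[OF h] by (subst (asm) integral_nonneg_eq_0_iff_AE) auto
    moreover have "AE y in N. U ?h y = U f y + U (\<lambda>x. (- 1) * g x) y"
      by (rule add) (use f g in \<open>auto intro: integrable_mult_right\<close>)
    moreover have "AE y in N. U (\<lambda>x. (- 1) * g x) y = (- 1) * U g y"
      by (rule scale[OF g])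
    ultimately show ?thesis by eventually_elim simp
  qed
  define u where "u F = L1_class N (U (L1_rep F))" for F
  have u: "u (L1_class M f) = L1_class N (U f)" if f: "integrable M f" for f
    unfolding u_def using L1_rep_class[OF f] f
    by (subst L1_class_eq_iff) (auto intro!: int cong)
  have lin: "L1_linear M N u"
    unfolding L1_linear_def
  proof (intro conjI ballI allI funcsetI)
    fix F :: "('a \<Rightarrow> 'k) set" assume "F \<in> L1_space M"
    then obtain f where f: "integrable M f" "F = L1_class M f" by (rule L1_spaceE)
    show "u F \<in> L1_space N" using f by (simp add: u int L1_class_in_space)
    show "u (L1_scale M c F) = L1_scale N c (u F)" for c
      using f scale[OF f(1), of c]
      by (simp add: u int L1_scale_class L1_class_eq_iff)
    fix G :: "('a \<Rightarrow> 'k) set" assume "G \<in> L1_space M"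
    then obtain g where g: "integrable M g" "G = L1_class M g" by (rule L1_spaceE)
    show "u (L1_add M F G) = L1_add N (u F) (u G)"
      using f g add[OF f(1) g(1)]
      by (simp add: u int L1_add_class L1_class_eq_iff)
  qed
  have norm: "L1_norm N (u F) \<le> L1_norm M F" if "F \<in> L1_space M" for F :: "('a \<Rightarrow> 'k) set"
    using that contr by (elim L1_spaceE) (simp add: u int L1_norm_class)
  have "u (L1_class M (\<lambda>_. 1)) = L1_class N (\<lambda>_. 1)"
    using one int[of "\<lambda>_. 1"] by (simp add: u L1_class_eq_iff)
  then have one': "L1_norm N (u (L1_class M (\<lambda>_. 1))) = 1" 
    by (simp add: L1_norm_class N.prob_space)
  have opnorm: "L1_opnorm M N u = 1"
    unfolding L1_opnorm_def
  proof (rule antisym)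
    show "(SUP F\<in>{F \<in> L1_space M. L1_norm M F \<le> 1}. ennreal (L1_norm N (u F))) \<le> 1"
      using norm by (intro SUP_least) (fastforce intro: order_trans)
    show "1 \<le> (SUP F\<in>{F \<in> L1_space M. L1_norm M F \<le> 1}. ennreal (L1_norm N (u F)))"
      by (rule SUP_upper2[of "L1_class M (\<lambda>_. 1)"])
         (simp_all add: one' L1_class_in_space L1_norm_class M.prob_space)
  qed
  show thesis by (rule that[OF lin opnorm]) (simp add: u)
qed

section \<open>Regression functions\<close>

text \<open>
  This says \<open>E[f | X] = g \<circ> X\<close> almost everywhere, by duality with bounded test functions. The
  conditional expectation is carried as a function on the state space because it then can
  be composed with any other variable that has the law of \<open>X\<close>. Complex test functions reach the
  phase of \<open>g\<close>, which gives the exact bound on the norm below.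
\<close>

definition regression ::
    "'a measure \<Rightarrow> 's measure \<Rightarrow> ('a \<Rightarrow> 's) \<Rightarrow> ('a \<Rightarrow> complex) \<Rightarrow> ('s \<Rightarrow> complex) \<Rightarrow> bool" where
  "regression M S X f g \<longleftrightarrow> integrable M f \<and> integrable (distr M S X) g \<and>
     (\<forall>h\<in>borel_measurable S. (\<forall>s. norm (h s) \<le> 1) \<longrightarrow>
        (\<integral>s. h s * g s \<partial>distr M S X) = (\<integral>x. h (X x) * f x \<partial>M))"

lemma integrable_bounded_mult:
  fixes h f :: "'a \<Rightarrow> complex"
  assumes "integrable M f" and "h \<in> borel_measurable M" and "\<And>x. norm (h x) \<le> 1"
  shows "integrable M (\<lambda>x. h x * f x)"
proof (rule Bochner_Integration.integrable_bound[OF assms(1)])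
  show "AE x in M. norm (h x * f x) \<le> norm (f x)"
    using assms(3) by (intro AE_I2) (auto simp: norm_mult intro: mult_left_le_one_le)
qed (use assms in auto)

text \<open>
  The test function \<open>h = cnj g / |g|\<close> turns the left-hand side into \<open>\<integral> h (X x) f x\<close>. By linearity the
  same bound, applied to \<open>f = 0\<close>, gives uniqueness (\<open>regression_unique\<close>).
\<close>

lemma regression_norm_le:
  assumes r: "regression M S X f g" and X: "X \<in> measurable M S"
  shows "(\<integral>s. norm (g s) \<partial>distr M S X) \<le> (\<integral>x. norm (f x) \<partial>M)"
proof -
  from r have [measurable]: "g \<in> borel_measurable S" and f: "integrable M f"
    by (auto simp: regression_def dest: borel_measurable_integrable)
  define h where "h s = cnj (g s) / complex_of_real (norm (g s))" for s
  have "continuous_on UNIV cnj" "continuous_on UNIV complex_of_real" by (intro continuous_intros)+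
  note [measurable] = this[THEN borel_measurable_continuous_onI]
  have h[measurable]: "h \<in> borel_measurable S" unfolding h_def by measurable
  have h1: "norm (h s) \<le> 1" for s by (simp add: h_def norm_divide)
  have hg: "h s * g s = complex_of_real (norm (g s))" for s
    by (simp add: h_def complex_norm_square[symmetric] mult.commute power2_eq_square)
  have "complex_of_real (\<integral>s. norm (g s) \<partial>distr M S X) = (\<integral>s. h s * g s \<partial>distr M S X)"
    by (simp add: hg)
  also have "\<dots> = (\<integral>x. h (X x) * f x \<partial>M)"
    using r h h1 by (auto simp: regression_def)
  finally have "(\<integral>s. norm (g s) \<partial>distr M S X) \<le> norm (\<integral>x. h (X x) * f x \<partial>M)"
    by (metis complex_Re_le_cmod Re_complex_of_real)
  also have "\<dots> \<le> (\<integral>x. norm (h (X x) * f x) \<partial>M)" by (rule integral_norm_bound)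
  also have "\<dots> \<le> (\<integral>x. norm (f x) \<partial>M)"
    using f X h1 by (intro integral_mono integrable_norm integrable_bounded_mult)
      (auto simp: norm_mult intro: mult_left_le_one_le)
  finally show ?thesis .
qed

lemma regression_add:
  assumes r: "regression M S X f g" "regression M S X f' g'" and X: "X \<in> measurable M S"
  shows "regression M S X (\<lambda>x. f x + f' x) (\<lambda>s. g s + g' s)"
  unfolding regression_def
proof (intro conjI ballI impI)
  fix h :: "_ \<Rightarrow> complex" assume h: "h \<in> borel_measurable S" "\<forall>s. norm (h s) \<le> 1"
  have i: "integrable M (\<lambda>x. h (X x) * f x)" "integrable M (\<lambda>x. h (X x) * f' x)"
    "integrable (distr M S X) (\<lambda>s. h s * g s)" "integrable (distr M S X) (\<lambda>s. h s * g' s)"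
    using r h X by (auto simp: regression_def intro!: integrable_bounded_mult)
  then show "(\<integral>s. h s * (g s + g' s) \<partial>distr M S X) = (\<integral>x. h (X x) * (f x + f' x) \<partial>M)"
    using r h by (simp add: ring_distribs regression_def)
qed (use r in \<open>auto simp: regression_def\<close>)

lemma regression_scale:
  assumes r: "regression M S X f g"
  shows "regression M S X (\<lambda>x. c * f x) (\<lambda>s. c * g s)"
  unfolding regression_def
proof (intro conjI ballI impI)
  fix h :: "_ \<Rightarrow> complex" assume h: "h \<in> borel_measurable S" "\<forall>s. norm (h s) \<le> 1"
  then show "(\<integral>s. h s * (c * g s) \<partial>distr M S X) = (\<integral>x. h (X x) * (c * f x) \<partial>M)"
    using r by (simp add: regression_def mult.left_commute[of _ c])
qed (use r in \<open>auto simp: regression_def\<close>)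

lemma regression_compose:
  assumes X[measurable]: "X \<in> measurable M S" and h[measurable]: "h \<in> borel_measurable S"
    and "integrable M (\<lambda>x. h (X x))"
  shows "regression M S X (\<lambda>x. h (X x)) h"
  unfolding regression_def using assms by (auto simp: integrable_distr_eq integral_distr)

lemma regression_unique:
  assumes r: "regression M S X f g" "regression M S X f g'" and X: "X \<in> measurable M S"
  shows "AE s in distr M S X. g s = g' s"
proof -
  have "regression M S X (\<lambda>x. f x + (- 1) * f x) (\<lambda>s. g s + (- 1) * g' s)"
    by (intro regression_add regression_scale r X)
  from regression_norm_le[OF this X]
  have "(\<integral>s. norm (g s - g' s) \<partial>distr M S X) = 0"
    by (intro antisym Bochner_Integration.integral_nonneg) simp_all
  then have "AE s in distr M S X. g s - g' s = 0"
    using r by (subst (asm) integral_nonneg_eq_0_iff_AE) (auto simp: regression_def)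
  then show ?thesis by simp
qed

text \<open>
  The image under \<open>X\<close> of the measure with density \<open>f\<close> is absolutely continuous with respect to
  the law of \<open>X\<close>; its Radon-Nikodym derivative is the regression function.
\<close>

lemma regression_exists_nonneg:
  fixes f :: "'a \<Rightarrow> real"
  assumes "finite_measure M" and X[measurable]: "X \<in> measurable M S"
    and f: "integrable M f" and pos: "\<And>x. 0 \<le> f x"
  shows "\<exists>g. regression M S X (\<lambda>x. complex_of_real (f x)) g"
proof -
  interpret M: finite_measure M by fact
  note [measurable] = borel_measurable_integrable[OF f]
  let ?\<mu> = "distr M S X" and ?\<nu> = "distr (density M f) S X"
  interpret mu: finite_measure ?\<mu> by (rule M.finite_measure_distr[OF X])
  have nu: "finite_measure ?\<nu>"
  proof (rule finite_measure.finite_measure_distr)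
    have "emeasure (density M f) (space (density M f)) = ennreal (\<integral>x. f x \<partial>M)"
      using f pos by (simp add: emeasure_density nn_integral_eq_integral cong: nn_integral_cong)
    then show "finite_measure (density M f)" by (intro finite_measureI) simp
  qed simp
  have ac: "absolutely_continuous ?\<mu> ?\<nu>"
    unfolding absolutely_continuous_def
  proof
    fix A assume "A \<in> null_sets ?\<mu>"
    then have A: "A \<in> sets S" "X -` A \<inter> space M \<in> null_sets M"
      by (auto simp: null_sets_def emeasure_distr)
    then have "X -` A \<inter> space M \<in> null_sets (density M f)"
      using absolutely_continuousI_density[of "\<lambda>x. ennreal (f x)" M]
      by (auto simp: absolutely_continuous_def)
    then show "A \<in> null_sets ?\<nu>" using A by (auto simp: null_sets_def emeasure_distr)
  qed
  obtain D where D: "D \<in> borel_measurable ?\<mu>" "AE s in ?\<mu>. RN_deriv ?\<mu> ?\<nu> s = ennreal (D s)" "\<And>s. 0 \<le> D s"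
    using mu.real_RN_deriv[OF nu ac] by auto
  have [measurable]: "D \<in> borel_measurable S" using D by simp
  have eq: "density ?\<mu> D = ?\<nu>"
    using mu.density_RN_deriv[OF ac] density_cong[OF _ _ D(2)] D(1) by simp
  have tr: "(\<integral>s. h s * complex_of_real (D s) \<partial>?\<mu>) = (\<integral>x. h (X x) * complex_of_real (f x) \<partial>M)"
    if [measurable]: "h \<in> borel_measurable S" for h :: "_ \<Rightarrow> complex"
  proof -
    have "(\<integral>s. h s * complex_of_real (D s) \<partial>?\<mu>) = (\<integral>s. h s \<partial>density ?\<mu> D)"
      using D(3) by (subst integral_density) (simp_all add: scaleR_conv_of_real mult.commute)
    also have "\<dots> = (\<integral>x. h (X x) \<partial>density M f)" unfolding eq by (rule integral_distr) simp_all
    also have "\<dots> = (\<integral>x. h (X x) * complex_of_real (f x) \<partial>M)"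
      using pos by (subst integral_density) (simp_all add: scaleR_conv_of_real mult.commute)
    finally show ?thesis .
  qed
  have "integrable ?\<mu> D"
  proof -
    have "integrable (density ?\<mu> D) (\<lambda>_. 1::real)"
      unfolding eq by (rule finite_measure.integrable_const[OF nu])
    then show ?thesis using D(3) by (subst (asm) integrable_density) simp_all
  qed
  with tr f show ?thesis unfolding regression_def by (intro exI[of _ "\<lambda>s. complex_of_real (D s)"]) auto
qed

lemma regression_exists:
  assumes M: "finite_measure M" and X: "X \<in> measurable M S" and f: "integrable M f"
  shows "\<exists>g. regression M S X f g"
proof -
  have real: "\<exists>g. regression M S X (\<lambda>x. complex_of_real (p x)) g"
    if p: "integrable M p" for p :: "'a \<Rightarrow> real"
  proof -
    obtain g1 where 1: "regression M S X (\<lambda>x. complex_of_real (max 0 (p x))) g1"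
      using regression_exists_nonneg[OF M X, of "\<lambda>x. max 0 (p x)"] p by auto
    obtain g2 where 2: "regression M S X (\<lambda>x. complex_of_real (max 0 (- p x))) g2"
      using regression_exists_nonneg[OF M X, of "\<lambda>x. max 0 (- p x)"] p by auto
    have "complex_of_real (max 0 t) + (- 1) * complex_of_real (max 0 (- t)) = complex_of_real t" for t
      by (simp add: max_def)
    with regression_add[OF 1 regression_scale[OF 2, of "- 1"] X] show ?thesis by auto
  qed
  obtain g1 where 1: "regression M S X (\<lambda>x. complex_of_real (Re (f x))) g1"
    using real[of "\<lambda>x. Re (f x)"] f by auto
  obtain g2 where 2: "regression M S X (\<lambda>x. complex_of_real (Im (f x))) g2"
    using real[of "\<lambda>x. Im (f x)"] f by auto
  have "complex_of_real (Re z) + \<i> * complex_of_real (Im z) = z" for z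
    by (rule complex_eq[symmetric])
  with regression_add[OF 1 regression_scale[OF 2, of "\<i>"] X] show ?thesis by auto
qed

section \<open>Transport along two variables of equal law\<close>

text \<open>
  The operator is \<open>E[f | X] = g \<circ> X \<mapsto> g \<circ> Y \<mapsto> \<integral> g (Y (y, w)) dw\<close>: two conditional
  expectations, which are contractions, with an isometry in between that exists because \<open>X\<close> and
  \<open>Y\<close> have the same law. The second conditional expectation, given the first coordinate of the
  product, is an integral over the second one.
\<close>

lemma operator_of_equal_laws:
  assumes "prob_space M" and "prob_space N" and "prob_space W"
    and X[measurable]: "X \<in> measurable M S" and Y[measurable]: "Y \<in> measurable (N \<Otimes>\<^sub>M W) S"
    and law: "distr M S X = distr (N \<Otimes>\<^sub>M W) S Y"
  obtains T :: "('a \<Rightarrow> complex) \<Rightarrow> 'b \<Rightarrow> complex"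
  where "L1_contraction M N T"
    and "\<forall>h\<in>borel_measurable S. integrable M (\<lambda>x. h (X x)) \<longrightarrow>
      (AE y in N. T (\<lambda>x. h (X x)) y = (\<integral>w. h (Y (y, w)) \<partial>W))"
proof -
  interpret M: prob_space M by fact
  interpret N: prob_space N by fact
  interpret W: prob_space W by fact
  interpret NW: pair_prob_space N W ..
  let ?\<mu> = "distr M S X"
  define G where "G f = (SOME g. regression M S X f g)" for f
  have G: "regression M S X f (G f)" if "integrable M f" for f
    unfolding G_def using regression_exists[OF M.finite_measure_axioms X that] by (rule someI_ex)
  have G_int: "integrable ?\<mu> (G f)" if "integrable M f" for f
    using G[OF that] by (simp add: regression_def)
  define I where "I g y = (\<integral>w. g (Y (y, w)) \<partial>W)" for g :: "_ \<Rightarrow> complex" and y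
  have pair_int: "integrable (N \<Otimes>\<^sub>M W) (\<lambda>p. g (Y p))" if "integrable ?\<mu> g" for g :: "_ \<Rightarrow> complex"
    using that unfolding law by (rule integrable_distr[OF Y])
  have I_cong: "AE y in N. I g y = I g' y"
    if g: "g \<in> borel_measurable S" "g' \<in> borel_measurable S" and eq: "AE s in ?\<mu>. g s = g' s" for g g'
  proof -
    have "AE p in N \<Otimes>\<^sub>M W. g (Y p) = g' (Y p)"
      using eq unfolding law by (rule AE_distrD[OF Y])
    then have "AE y in N. AE w in W. g (Y (y, w)) = g' (Y (y, w))" by (rule NW.AE_pair)
    then show ?thesis using AE_space
    proof eventually_elim
      case (elim y)
      have [measurable]: "(\<lambda>w. Y (y, w)) \<in> measurable W S" using elim(2) by measurable
      note [measurable] = g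
      show ?case unfolding I_def using elim(1) by (intro integral_cong_AE) simp_all
    qed
  qed
  have meas: "g \<in> borel_measurable S" if "integrable ?\<mu> g" for g :: "_ \<Rightarrow> complex"
    using borel_measurable_integrable[OF that] by simp
  show thesis
  proof (rule that[of "\<lambda>f. I (G f)"], unfold L1_contraction_def, intro conjI allI impI)
    fix f :: "'a \<Rightarrow> complex" assume f: "integrable M f"
    note Gf = G_int[OF f]
    show "integrable N (I (G f))"
      unfolding I_def by (rule NW.integrable_fst'[OF pair_int[OF Gf]])
    show "AE y in N. I (G (\<lambda>x. c * f x)) y = c * I (G f) y" for c
    proof -
      have "AE s in ?\<mu>. G (\<lambda>x. c * f x) s = c * G f s"
        by (rule regression_unique[OF G regression_scale[OF G[OF f]] X]) (use f in simp)
      then have "AE y in N. I (G (\<lambda>x. c * f x)) y = I (\<lambda>s. c * G f s) y"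
        using f Gf by (intro I_cong meas G_int) auto
      then show ?thesis by (simp add: I_def)
    qed
    have "(\<integral>y. norm (I (G f) y) \<partial>N) \<le> (\<integral>y. (\<integral>w. norm (G f (Y (y, w))) \<partial>W) \<partial>N)"
      unfolding I_def
      by (intro integral_mono integral_norm_bound integrable_norm NW.integrable_fst' pair_int Gf
          NW.integrable_fst'[of "\<lambda>p. norm (G f (Y p))", simplified])
    also have "\<dots> = (\<integral>p. norm (G f (Y p)) \<partial>(N \<Otimes>\<^sub>M W))"
      by (rule NW.integral_fst') (intro integrable_norm pair_int Gf)
    also have "\<dots> = (\<integral>s. norm (G f s) \<partial>?\<mu>)"
      unfolding law using meas[OF Gf] by (subst integral_distr) auto
    also have "\<dots> \<le> (\<integral>x. norm (f x) \<partial>M)"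
      by (rule regression_norm_le[OF G[OF f] X])
    finally show "(\<integral>y. norm (I (G f) y) \<partial>N) \<le> (\<integral>x. norm (f x) \<partial>M)" .
    fix g :: "'a \<Rightarrow> complex" assume g: "integrable M g"
    note Gg = G_int[OF g]
    have "AE s in ?\<mu>. G (\<lambda>x. f x + g x) s = G f s + G g s"
      by (rule regression_unique[OF G regression_add[OF G[OF f] G[OF g] X] X]) (use f g in simp)
    then have "AE y in N. I (G (\<lambda>x. f x + g x)) y = I (\<lambda>s. G f s + G g s) y"
      using f g Gf Gg by (intro I_cong meas G_int) auto
    with NW.AE_integrable_fst'[OF pair_int[OF Gf]] NW.AE_integrable_fst'[OF pair_int[OF Gg]]
    show "AE y in N. I (G (\<lambda>x. f x + g x)) y = I (G f) y + I (G g) y"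
      by eventually_elim (simp add: I_def)
  next
    show "\<forall>h\<in>borel_measurable S. integrable M (\<lambda>x. h (X x)) \<longrightarrow>
      (AE y in N. I (G (\<lambda>x. h (X x))) y = (\<integral>w. h (Y (y, w)) \<partial>W))"
    proof (intro ballI impI)
      fix h :: "_ \<Rightarrow> complex"
      assume h: "h \<in> borel_measurable S" "integrable M (\<lambda>x. h (X x))"
      have "AE s in ?\<mu>. G (\<lambda>x. h (X x)) s = h s"
        by (rule regression_unique[OF G[OF h(2)] regression_compose[OF X h] X])
      then have "AE y in N. I (G (\<lambda>x. h (X x))) y = I h y"
        by (intro I_cong meas[OF G_int[OF h(2)]] h(1))
      then show "AE y in N. I (G (\<lambda>x. h (X x))) y = (\<integral>w. h (Y (y, w)) \<partial>W)" by (simp add: I_def)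
    qed
  qed
qed

section \<open>Coins of prescribed mean\<close>

text \<open>
  For \<open>|c| \<le> 1\<close>, the mass that the distribution on \<open>{1, -1}\<close> of mean \<open>c\<close> gives to \<open>F\<close>.
\<close>

definition coin_prob :: "real \<Rightarrow> real set \<Rightarrow> real" where
  "coin_prob c F = (1 + c) / 2 * indicator F 1 + (1 - c) / 2 * indicator F (- 1)"

lemma coin_prob_nonneg: "\<bar>c\<bar> \<le> 1 \<Longrightarrow> 0 \<le> coin_prob c F"
  by (simp add: coin_prob_def)

text \<open>
  For \<open>t\<close> uniform on \<open>[0, 1]\<close> and \<open>|c| \<le> 1\<close> this is a random sign of mean \<open>c\<close>. Being explicit, it
  depends measurably on \<open>c\<close> and \<open>t\<close> together.
\<close>

definition coin :: "real \<Rightarrow> real \<Rightarrow> real" where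
  "coin c t = (if 2 * t \<le> 1 + c then 1 else - 1)"

abbreviation unit_uniform :: "real measure" where
  "unit_uniform \<equiv> uniform_measure lborel {0..1}"

lemma prob_space_unit_uniform: "prob_space unit_uniform"
  by (rule prob_space_uniform_measure) simp_all

lemma coin_measurable[measurable]:
  assumes [measurable]: "f \<in> borel_measurable M" "g \<in> borel_measurable M"
  shows "(\<lambda>x. coin (f x) (g x)) \<in> borel_measurable M"
  unfolding coin_def by measurable

text \<open>
  The two probabilities add up to \<open>1\<close>, so no other value occurs with positive probability.
\<close>

lemma signs_law_and_mean:
  fixes X :: "'a \<Rightarrow> real"
  assumes "prob_space M" and [measurable]: "X \<in> borel_measurable M"
    and p: "measure M {x \<in> space M. X x = 1} = (1 + c) / 2"
      "measure M {x \<in> space M. X x = - 1} = (1 - c) / 2"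
  shows "F \<in> sets borel \<Longrightarrow> measure M {x \<in> space M. X x \<in> F} = coin_prob c F"
    and "(\<integral>x. X x \<partial>M) = c"
    and "integrable M X"
proof -
  interpret prob_space M by fact
  have "prob {x \<in> space M. X x = 1 \<or> X x = - 1} =
      prob ({x \<in> space M. X x = 1} \<union> {x \<in> space M. X x = - 1})"
    by (rule arg_cong[where f = prob]) auto
  also have "\<dots> = 1" by (subst finite_measure_Union) (auto simp: p field_simps)
  finally have ae: "AE x in M. X x = 1 \<or> X x = - 1" by (subst (asm) prob_Collect_eq_1) auto
  then have "AE x in M. norm (X x) \<le> 1" by eventually_elim auto
  then show "integrable M X" by (rule integrable_const_bound) fact
  show "prob {x \<in> space M. X x \<in> F} = coin_prob c F" if [measurable]: "F \<in> sets borel"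
  proof -
    have part: "prob {x \<in> space M. X x = v \<and> v \<in> F} = prob {x \<in> space M. X x = v} * indicator F v" for v
      by (cases "v \<in> F") auto
    have "prob {x \<in> space M. X x \<in> F} =
        prob ({x \<in> space M. X x = 1 \<and> 1 \<in> F} \<union> {x \<in> space M. X x = - 1 \<and> - 1 \<in> F})"
      using ae by (intro finite_measure_eq_AE) auto
    also have "\<dots> = prob {x \<in> space M. X x = 1 \<and> 1 \<in> F} + prob {x \<in> space M. X x = - 1 \<and> - 1 \<in> F}"
      by (intro finite_measure_Union) auto
    also have "\<dots> = coin_prob c F" by (simp add: part p coin_prob_def)
    finally show ?thesis .
  qed
  have "(\<integral>x. X x \<partial>M) = (\<integral>x. 2 * indicator {x \<in> space M. X x = 1} x - 1 \<partial>M)"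
    using ae by (intro integral_cong_AE) (auto split: split_indicator)
  also have "\<dots> = 2 * prob {x \<in> space M. X x = 1} - 1" by (simp add: prob_space less_top[symmetric])
  finally show "(\<integral>x. X x \<partial>M) = c" unfolding p by (simp add: field_simps)
qed

lemma coin_probabilities:
  assumes c: "\<bar>c\<bar> \<le> 1"
  shows "measure unit_uniform {t \<in> space unit_uniform. coin c t = 1} = (1 + c) / 2"
    and "measure unit_uniform {t \<in> space unit_uniform. coin c t = - 1} = (1 - c) / 2"
proof -
  interpret prob_space unit_uniform by (rule prob_space_unit_uniform)
  have e: "{0..1} \<inter> {t. coin c t = 1} = {0..(1 + c) / 2}"
    using c by (auto simp: coin_def split: if_splits)
  have m: "{t. coin c t = 1} \<in> sets borel" by measurable
  show *: "measure unit_uniform {t \<in> space unit_uniform. coin c t = 1} = (1 + c) / 2"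
    using c by (simp add: measure_uniform_measure e m)
  have "{t \<in> space unit_uniform. coin c t = - 1} = space unit_uniform - {t \<in> space unit_uniform. coin c t = 1}"
    by (auto simp: coin_def)
  also have "prob \<dots> = 1 - (1 + c) / 2" unfolding *[symmetric] using m by (intro prob_compl) simp
  finally show "prob {t \<in> space unit_uniform. coin c t = - 1} = (1 - c) / 2" by (simp add: field_simps)
qed

lemma coin_law:
  assumes "\<bar>c\<bar> \<le> 1" and "F \<in> sets borel"
  shows "emeasure unit_uniform {t. coin c t \<in> F} = ennreal (coin_prob c F)"
proof -
  interpret prob_space unit_uniform by (rule prob_space_unit_uniform)
  show ?thesis
    using signs_law_and_mean(1)[OF prob_space_unit_uniform _ coin_probabilities[OF assms(1)] assms(2)]
    unfolding emeasure_eq_measure by simp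
qed

lemma coin_mean:
  assumes "\<bar>c\<bar> \<le> 1"
  shows "(\<integral>t. coin c t \<partial>unit_uniform) = c"
  using signs_law_and_mean(2)[OF prob_space_unit_uniform _ coin_probabilities[OF assms]] by simp

section \<open>A sign sequence above the martingale differences\<close>

text \<open>
  Expand the factor of largest index: the product of the others is measurable with respect to
  the preceding sigma-algebra, hence orthogonal to the martingale difference, and only the constant
  term survives. Thus bounded martingale differences cannot be distinguished from \<open>0\<close> by such
  products.
\<close>

lemma martingale_difference_product:
  fixes d :: "nat \<Rightarrow> 'b \<Rightarrow> real"
  assumes "prob_space N"
    and sub: "\<And>n. subalgebra N (A n)" and fil: "filtration (space N) A"
    and meas: "\<And>n. d n \<in> borel_measurable (A n)"
    and mart: "\<And>n. n \<ge> 1 \<Longrightarrow> AE y in N. real_cond_exp N (A (n - 1)) (d n) y = 0"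
    and bound: "\<And>n. AE y in N. \<bar>d n y\<bar> \<le> 1"
    and J: "finite J" "J \<subseteq> {1..}"
  shows "integrable N (\<lambda>y. \<Prod>j\<in>J. a j + b j * d j y)"
    and "(\<integral>y. (\<Prod>j\<in>J. a j + b j * d j y) \<partial>N) = (\<Prod>j\<in>J. a j)"
proof -
  interpret prob_space N by fact
  interpret filtration "space N" A by fact
  have meas_prod: "(\<lambda>y. \<Prod>j\<in>K. a j + b j * d j y) \<in> borel_measurable (A n)"
    if "\<And>j. j \<in> K \<Longrightarrow> j \<le> n" for K n
  proof (intro borel_measurable_prod borel_measurable_add borel_measurable_times borel_measurable_const)
    fix j assume "j \<in> K"
    then have "subalgebra (A n) (A j)"
      using that by (auto simp: subalgebra_def space_F dest: sets_F_mono)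
    then show "d j \<in> borel_measurable (A n)" using meas by (rule measurable_from_subalg)
  qed
  have int: "integrable N (\<lambda>y. \<Prod>j\<in>K. a j + b j * d j y)" if K: "finite K" for K
  proof (rule integrable_const_bound)
    have "AE y in N. \<forall>j\<in>K. \<bar>d j y\<bar> \<le> 1" using bound K by (intro AE_finite_allI) auto
    then show "AE y in N. norm (\<Prod>j\<in>K. a j + b j * d j y) \<le> (\<Prod>j\<in>K. \<bar>a j\<bar> + \<bar>b j\<bar>)"
    proof eventually_elim
      case (elim y)
      have "\<bar>a j + b j * d j y\<bar> \<le> \<bar>a j\<bar> + \<bar>b j\<bar>" if "j \<in> K" for j
        using elim that mult_left_mono[of "\<bar>d j y\<bar>" 1 "\<bar>b j\<bar>"]
        by (intro order_trans[OF abs_triangle_ineq]) (auto simp: abs_mult)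
      then show ?case by (auto simp: abs_prod intro!: prod_mono)
    qed
    have "(\<lambda>y. \<Prod>j\<in>K. a j + b j * d j y) \<in> borel_measurable (A (Max (insert 0 K)))"
      using K by (intro meas_prod) simp
    then show "(\<lambda>y. \<Prod>j\<in>K. a j + b j * d j y) \<in> borel_measurable N"
      by (rule measurable_from_subalg[OF sub])
  qed
  show "integrable N (\<lambda>y. \<Prod>j\<in>J. a j + b j * d j y)" by (rule int[OF J(1)])
  show "(\<integral>y. (\<Prod>j\<in>J. a j + b j * d j y) \<partial>N) = (\<Prod>j\<in>J. a j)"
    using J
  proof (induction J rule: finite_linorder_max_induct)
    case empty
    then show ?case by (simp add: prob_space)
  next
    case (insert n K)
    let ?P = "\<lambda>y. \<Prod>j\<in>K. a j + b j * d j y"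
    interpret C: finite_measure_subalgebra N "A (n - 1)"
      by unfold_locales (rule sub)
    have P: "?P \<in> borel_measurable (A (n - 1))"
      using insert.hyps by (intro meas_prod) fastforce
    have P_N: "?P \<in> borel_measurable N" by (rule measurable_from_subalg[OF sub P])
    have d: "d n \<in> borel_measurable N" by (rule measurable_from_subalg[OF sub meas])
    have Pd: "integrable N (\<lambda>y. ?P y * d n y)"
    proof (rule Bochner_Integration.integrable_bound[OF int])
      show "AE y in N. norm (?P y * d n y) \<le> norm (?P y)"
        using bound[of n] by eventually_elim (simp add: abs_mult mult_left_le)
      show "(\<lambda>y. ?P y * d n y) \<in> borel_measurable N"
        by (intro borel_measurable_times d P_N)
    qed (rule insert.hyps)
    have "(\<integral>y. ?P y * d n y \<partial>N) = (\<integral>y. ?P y * real_cond_exp N (A (n - 1)) (d n) y \<partial>N)"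
      by (rule C.real_cond_exp_intg(2)[OF Pd P d, symmetric])
    also have "\<dots> = (\<integral>y. 0 \<partial>N)"
      using mart[of n] insert.prems P_N by (intro integral_cong_AE) auto
    finally have zero: "(\<integral>y. ?P y * d n y \<partial>N) = 0" by simp
    have "(\<integral>y. (\<Prod>j\<in>insert n K. a j + b j * d j y) \<partial>N) = (\<integral>y. a n * ?P y + b n * (?P y * d n y) \<partial>N)"
      using insert.hyps by (subst prod.insert) (auto simp: algebra_simps)
    also have "\<dots> = a n * (\<integral>y. ?P y \<partial>N) + b n * (\<integral>y. ?P y * d n y \<partial>N)"
      using int[OF insert.hyps(1)] Pd by simp
    finally show ?case using zero insert by (subst prod.insert) auto
  qed
qed

text \<open>
  Finite-dimensional cylinders generate the product sigma-algebra and are stable under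
  intersection.
\<close>

lemma sequence_law_eqI:
  fixes X :: "'a \<Rightarrow> 'i \<Rightarrow> real" and Y :: "'b \<Rightarrow> 'i \<Rightarrow> real"
  assumes "prob_space M" and "prob_space N"
    and X[measurable]: "X \<in> measurable M (\<Pi>\<^sub>M i\<in>I. borel)"
    and Y[measurable]: "Y \<in> measurable N (\<Pi>\<^sub>M i\<in>I. borel)"
    and eq: "\<And>J F. finite J \<Longrightarrow> J \<subseteq> I \<Longrightarrow> (\<And>i. i \<in> J \<Longrightarrow> F i \<in> sets borel) \<Longrightarrow>
      measure M {x \<in> space M. \<forall>i\<in>J. X x i \<in> F i} = measure N {y \<in> space N. \<forall>i\<in>J. Y y i \<in> F i}"
  shows "distr M (\<Pi>\<^sub>M i\<in>I. borel) X = distr N (\<Pi>\<^sub>M i\<in>I. borel) Y"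
proof (rule measure_eqI_PiM_infinite)
  interpret M: prob_space M by fact
  interpret N: prob_space N by fact
  show "finite_measure (distr M (\<Pi>\<^sub>M i\<in>I. borel) X)" by (rule M.finite_measure_distr[OF X])
  fix J and F :: "'i \<Rightarrow> real set"
  assume J: "finite J" "J \<subseteq> I" "\<And>i. i \<in> J \<Longrightarrow> F i \<in> sets borel"
  have E: "prod_emb I (\<lambda>_. borel) J (Pi\<^sub>E J F) \<in> sets (\<Pi>\<^sub>M i\<in>I. borel)"
    using J by (intro sets_PiM_I) auto
  have v: "Z -` prod_emb I (\<lambda>_. borel) J (Pi\<^sub>E J F) \<inter> space P = {z \<in> space P. \<forall>i\<in>J. Z z i \<in> F i}"
    if "Z \<in> measurable P (\<Pi>\<^sub>M i\<in>I. borel)" for Z :: "'c \<Rightarrow> 'i \<Rightarrow> real" and P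
    using measurable_space[OF that] J(2) by (auto simp: prod_emb_def space_PiM restrict_PiE_iff)
  show "emeasure (distr M (\<Pi>\<^sub>M i\<in>I. borel) X) (prod_emb I (\<lambda>_. borel) J (Pi\<^sub>E J F)) =
      emeasure (distr N (\<Pi>\<^sub>M i\<in>I. borel) Y) (prod_emb I (\<lambda>_. borel) J (Pi\<^sub>E J F))"
    using E eq[OF J] by (simp add: emeasure_distr v M.emeasure_eq_measure N.emeasure_eq_measure)
qed simp_all

text \<open>
  When the coordinates of \<open>w\<close> are independent and uniform on \<open>[0, 1]\<close> and \<open>|d n y| \<le> 1\<close>, these are
  independent signs with means \<open>d n y\<close>. The index set is \<open>{1..}\<close>, the one of the given sign
  sequence, so that both sequences live on the same product space.
\<close>

definition coins :: "(nat \<Rightarrow> 'b \<Rightarrow> real) \<Rightarrow> 'b \<times> (nat \<Rightarrow> real) \<Rightarrow> nat \<Rightarrow> real" where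
  "coins d = (\<lambda>(y, w). \<lambda>n\<in>{1..}. coin (d n y) (w n))"

lemma coins_measurable:
  assumes [measurable]: "\<And>n. d n \<in> borel_measurable N"
  shows "coins d \<in> measurable (N \<Otimes>\<^sub>M (\<Pi>\<^sub>M n\<in>{1..}. unit_uniform)) (\<Pi>\<^sub>M n\<in>{1..}. borel)"
  unfolding coins_def case_prod_beta
proof (intro measurable_restrict coin_measurable)
  fix n :: nat assume n: "n \<in> {1..}"
  show "(\<lambda>p. d n (fst p)) \<in> borel_measurable (N \<Otimes>\<^sub>M (\<Pi>\<^sub>M n\<in>{1..}. unit_uniform))" by measurable
  have "(\<lambda>p. snd p n) \<in> measurable (N \<Otimes>\<^sub>M (\<Pi>\<^sub>M n\<in>{1..}. unit_uniform)) unit_uniform"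
    using n by measurable
  then show "(\<lambda>p. snd p n) \<in> borel_measurable (N \<Otimes>\<^sub>M (\<Pi>\<^sub>M n\<in>{1..}. unit_uniform))"
    by (simp cong: measurable_cong_sets)
qed

text \<open>
  Given \<open>y\<close>, the cylinder has as probability a product of terms affine in the numbers \<open>d j y\<close>;
  averaging over \<open>y\<close> replaces each of them by its value at \<open>0\<close>, which describes independent fair
  coins.
\<close>

lemma coins_law:
  fixes d :: "nat \<Rightarrow> 'b \<Rightarrow> real"
  assumes N: "prob_space N"
    and sub: "\<And>n. subalgebra N (A n)" and fil: "filtration (space N) A"
    and meas: "\<And>n. d n \<in> borel_measurable (A n)"
    and mart: "\<And>n. n \<ge> 1 \<Longrightarrow> AE y in N. real_cond_exp N (A (n - 1)) (d n) y = 0"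
    and bound: "\<And>n. AE y in N. \<bar>d n y\<bar> \<le> 1"
    and J: "finite J" "J \<subseteq> {1..}" and F: "\<And>j. j \<in> J \<Longrightarrow> F j \<in> sets borel"
  shows "measure (N \<Otimes>\<^sub>M (\<Pi>\<^sub>M n\<in>{1..}. unit_uniform))
      {p \<in> space (N \<Otimes>\<^sub>M (\<Pi>\<^sub>M n\<in>{1..}. unit_uniform)). \<forall>j\<in>J. coins d p j \<in> F j} =
    (\<Prod>j\<in>J. coin_prob 0 (F j))"
proof -
  let ?W = "\<Pi>\<^sub>M n\<in>{1::nat..}. unit_uniform"
  interpret N: prob_space N by fact
  interpret W: prob_space ?W by (intro prob_space_PiM prob_space_unit_uniform)
  interpret product_prob_space "\<lambda>_. unit_uniform" "{1::nat..}"
    by (intro product_prob_spaceI prob_space_unit_uniform)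
  interpret NW: pair_prob_space N ?W ..
  have d: "d n \<in> borel_measurable N" for n by (rule measurable_from_subalg[OF sub meas])
  let ?E = "{p \<in> space (N \<Otimes>\<^sub>M ?W). \<forall>j\<in>J. coins d p j \<in> F j}"
  have E: "?E \<in> sets (N \<Otimes>\<^sub>M ?W)"
  proof (rule sets.sets_Collect_finite_All[OF _ J(1)])
    fix j assume j: "j \<in> J"
    then have "(\<lambda>p. coins d p j) \<in> borel_measurable (N \<Otimes>\<^sub>M ?W)"
      using J(2) by (intro measurable_compose[OF coins_measurable[OF d] measurable_component_singleton]) auto
    then show "{p \<in> space (N \<Otimes>\<^sub>M ?W). coins d p j \<in> F j} \<in> sets (N \<Otimes>\<^sub>M ?W)"
      using F[OF j] by measurable
  qed
  have bounds: "AE y in N. \<forall>j\<in>J. \<bar>d j y\<bar> \<le> 1" using bound J(1) by (intro AE_finite_allI) auto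
  \<comment> \<open>\<open>coin_prob c (F j)\<close> is affine in \<open>c\<close>, with slope \<open>b j\<close>.\<close>
  define b :: "nat \<Rightarrow> real" where "b j = (indicator (F j) 1 - indicator (F j) (- 1)) / 2" for j
  have affine: "coin_prob c (F j) = coin_prob 0 (F j) + b j * c" for c j
    by (simp add: coin_prob_def b_def field_simps)
  note expand = martingale_difference_product[OF N sub fil meas mart bound J]
  have "ennreal (measure (N \<Otimes>\<^sub>M ?W) ?E) = emeasure (N \<Otimes>\<^sub>M ?W) ?E"
    by (rule NW.emeasure_eq_measure[symmetric])
  also have "\<dots> = (\<integral>\<^sup>+y. emeasure ?W (Pair y -` ?E) \<partial>N)"
    by (rule W.emeasure_pair_measure_alt[OF E])
  also have "\<dots> = (\<integral>\<^sup>+y. ennreal (\<Prod>j\<in>J. coin_prob (d j y) (F j)) \<partial>N)"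
  proof (rule nn_integral_cong_AE)
    show "AE y in N. emeasure ?W (Pair y -` ?E) = ennreal (\<Prod>j\<in>J. coin_prob (d j y) (F j))"
      using bounds AE_space
    proof eventually_elim
      case (elim y)
      have m: "{t. coin (d j y) t \<in> F j} \<in> sets unit_uniform" if "j \<in> J" for j
        using measurable_sets_Collect[of "coin (d j y)" borel borel "\<lambda>t. t \<in> F j"] F[OF that] by simp
      have "Pair y -` ?E = {w \<in> space ?W. \<forall>j\<in>J. w j \<in> {t. coin (d j y) t \<in> F j}}"
        using elim(2) J(2) by (auto simp: space_pair_measure coins_def)
      also have "emeasure ?W \<dots> = (\<Prod>j\<in>J. emeasure unit_uniform {t. coin (d j y) t \<in> F j})"
        using J m by (intro emeasure_PiM_Collect)
      also have "\<dots> = (\<Prod>j\<in>J. ennreal (coin_prob (d j y) (F j)))"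
        using elim(1) F by (intro prod.cong refl coin_law) auto
      also have "\<dots> = ennreal (\<Prod>j\<in>J. coin_prob (d j y) (F j))"
        using elim(1) F by (intro prod_ennreal) (simp add: coin_prob_nonneg)
      finally show ?case .
    qed
  qed
  also have "\<dots> = (\<integral>\<^sup>+y. ennreal (\<Prod>j\<in>J. coin_prob 0 (F j) + b j * d j y) \<partial>N)"
    by (intro nn_integral_cong arg_cong[where f = ennreal] prod.cong refl affine)
  also have "\<dots> = ennreal (\<integral>y. (\<Prod>j\<in>J. coin_prob 0 (F j) + b j * d j y) \<partial>N)"
  proof (rule nn_integral_eq_integral[OF expand(1)])
    show "AE y in N. 0 \<le> (\<Prod>j\<in>J. coin_prob 0 (F j) + b j * d j y)"
      using bounds
    proof eventually_elim
      case (elim y)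
      then have "0 \<le> (\<Prod>j\<in>J. coin_prob (d j y) (F j))" by (simp add: coin_prob_nonneg prod_nonneg)
      also have "\<dots> = (\<Prod>j\<in>J. coin_prob 0 (F j) + b j * d j y)" by (intro prod.cong refl affine)
      finally show ?case .
    qed
  qed
  also have "\<dots> = ennreal (\<Prod>j\<in>J. coin_prob 0 (F j))" by (simp only: expand(2))
  finally show ?thesis by (simp add: coin_prob_nonneg prod_nonneg)
qed

lemma independent_signs_law:
  fixes \<epsilon> :: "'i \<Rightarrow> 'a \<Rightarrow> real"
  assumes "prob_space M" and ind: "prob_space.indep_vars M (\<lambda>_. borel) \<epsilon> I"
    and p: "\<And>i. i \<in> I \<Longrightarrow> measure M {x \<in> space M. \<epsilon> i x = 1} = 1 / 2"
      "\<And>i. i \<in> I \<Longrightarrow> measure M {x \<in> space M. \<epsilon> i x = - 1} = 1 / 2"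
    and J: "finite J" "J \<subseteq> I" and F: "\<And>j. j \<in> J \<Longrightarrow> F j \<in> sets borel"
  shows "measure M {x \<in> space M. \<forall>j\<in>J. \<epsilon> j x \<in> F j} = (\<Prod>j\<in>J. coin_prob 0 (F j))"
proof (cases "J = {}")
  case True
  then show ?thesis using prob_space.prob_space[OF assms(1)] by simp
next
  case False
  interpret prob_space M by fact
  have "{x \<in> space M. \<forall>j\<in>J. \<epsilon> j x \<in> F j} = (\<Inter>j\<in>J. \<epsilon> j -` F j \<inter> space M)" using False by auto
  also have "prob \<dots> = (\<Prod>j\<in>J. prob (\<epsilon> j -` F j \<inter> space M))"
    by (rule indep_varsD[OF ind False J F])
  also have "\<dots> = (\<Prod>j\<in>J. coin_prob 0 (F j))"
  proof (intro prod.cong refl)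
    fix j assume j: "j \<in> J"
    have "\<epsilon> j -` F j \<inter> space M = {x \<in> space M. \<epsilon> j x \<in> F j}" by auto
    then show "prob (\<epsilon> j -` F j \<inter> space M) = coin_prob 0 (F j)"
      using ind j J(2) by (simp, intro signs_law_and_mean(1)[OF assms(1) _ _ _ F[OF j]])
        (auto simp: indep_vars_def p)
  qed
  finally show ?thesis .
qed

section \<open>Existence of the operator\<close>

theorem lemma10:
  fixes M :: "'a measure" and N :: "'b measure"
    and \<epsilon> :: "nat \<Rightarrow> 'a \<Rightarrow> real"
    and d :: "nat \<Rightarrow> 'b \<Rightarrow> real"
    and A :: "nat \<Rightarrow> 'b measure"
  assumes "prob_space M" and "prob_space N"
    and "prob_space.indep_vars M (\<lambda>_. borel) \<epsilon> {1..}"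
    and "\<And>n. n \<ge> 1 \<Longrightarrow> measure M {\<omega> \<in> space M. \<epsilon> n \<omega> = 1} = 1 / 2"
    and "\<And>n. n \<ge> 1 \<Longrightarrow> measure M {\<omega> \<in> space M. \<epsilon> n \<omega> = -1} = 1 / 2"
    and "\<And>n. subalgebra N (A n)"
    and "filtration (space N) A"
    and "\<And>n. d n \<in> borel_measurable (A n)"
    and "\<And>n. n \<ge> 1 \<Longrightarrow> AE \<omega> in N. real_cond_exp N (A (n - 1)) (d n) \<omega> = 0"
    and "sets (A 0) = {{}, space N}"
    and "\<And>n. AE \<omega> in N. \<bar>d n \<omega>\<bar> \<le> 1"
  shows "(\<exists>u :: ('a \<Rightarrow> real) set \<Rightarrow> ('b \<Rightarrow> real) set.
            L1_linear M N u \<and> L1_opnorm M N u = 1 \<and>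
            u (L1_class M (\<lambda>_. 1)) = L1_class N (\<lambda>_. 1) \<and>
            (\<forall>n\<ge>1. u (L1_class M (\<epsilon> n)) = L1_class N (d n))) \<and>
         (\<exists>u :: ('a \<Rightarrow> complex) set \<Rightarrow> ('b \<Rightarrow> complex) set.
            L1_linear M N u \<and> L1_opnorm M N u = 1 \<and>
            u (L1_class M (\<lambda>_. 1)) = L1_class N (\<lambda>_. 1) \<and>
            (\<forall>n\<ge>1. u (L1_class M (\<lambda>\<omega>. complex_of_real (\<epsilon> n \<omega>))) =
                     L1_class N (\<lambda>\<omega>. complex_of_real (d n \<omega>))))"
proof -
  interpret M: prob_space M by fact
  interpret N: prob_space N by fact
  let ?S = "\<Pi>\<^sub>M n\<in>{1::nat..}. (borel :: real measure)"
  let ?W = "\<Pi>\<^sub>M n\<in>{1::nat..}. unit_uniform"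
  interpret W: prob_space ?W by (intro prob_space_PiM prob_space_unit_uniform)
  interpret U: product_prob_space "\<lambda>_. unit_uniform" "{1::nat..}"
    by (intro product_prob_spaceI prob_space_unit_uniform)
  interpret NW: pair_prob_space N ?W ..
  have eps: "\<epsilon> n \<in> borel_measurable M" if "n \<ge> 1" for n
    using assms(3) that by (simp add: M.indep_vars_def)
  have d: "d n \<in> borel_measurable N" for n by (rule measurable_from_subalg[OF assms(6,8)])
  define X where "X x = (\<lambda>n\<in>{1..}. \<epsilon> n x)" for x
  have X: "X \<in> measurable M ?S" unfolding X_def using eps by (intro measurable_restrict) auto
  have Y: "coins d \<in> measurable (N \<Otimes>\<^sub>M ?W) ?S" by (rule coins_measurable[OF d])
  have law: "distr M ?S X = distr (N \<Otimes>\<^sub>M ?W) ?S (coins d)"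
  proof (rule sequence_law_eqI[OF assms(1) NW.prob_space_axioms X Y])
    fix J and F :: "nat \<Rightarrow> real set"
    assume J: "finite J" "J \<subseteq> {1..}" "\<And>j. j \<in> J \<Longrightarrow> F j \<in> sets borel"
    have "{x \<in> space M. \<forall>j\<in>J. X x j \<in> F j} = {x \<in> space M. \<forall>j\<in>J. \<epsilon> j x \<in> F j}"
      using J(2) by (auto simp: X_def)
    also have "M.prob \<dots> = (\<Prod>j\<in>J. coin_prob 0 (F j))"
      by (rule independent_signs_law[OF assms(1,3) _ _ J]) (use assms(4,5) in auto)
    also have "\<dots> = measure (N \<Otimes>\<^sub>M ?W) {p \<in> space (N \<Otimes>\<^sub>M ?W). \<forall>j\<in>J. coins d p j \<in> F j}"
      by (rule coins_law[OF assms(2,6-9,11) J, symmetric])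
    finally show "M.prob {x \<in> space M. \<forall>j\<in>J. X x j \<in> F j} =
      measure (N \<Otimes>\<^sub>M ?W) {p \<in> space (N \<Otimes>\<^sub>M ?W). \<forall>j\<in>J. coins d p j \<in> F j}" .
  qed
  obtain T :: "('a \<Rightarrow> complex) \<Rightarrow> 'b \<Rightarrow> complex"
    where T: "L1_contraction M N T"
      and T_fun: "\<forall>h\<in>borel_measurable ?S. integrable M (\<lambda>x. h (X x)) \<longrightarrow>
        (AE y in N. T (\<lambda>x. h (X x)) y = (\<integral>w. h (coins d (y, w)) \<partial>?W))"
    by (rule operator_of_equal_laws[OF assms(1,2) W.prob_space_axioms X Y law])
  note T_int = L1_contractionD(1)[OF T]
  have T_one: "AE y in N. T (\<lambda>_. 1) y = 1"
  proof -
    have "AE y in N. T (\<lambda>_. 1) y = (\<integral>w. 1 \<partial>?W)"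
      by (rule T_fun[rule_format, of "\<lambda>_. 1"]) (intro borel_measurable_const M.integrable_const)+
    moreover have "(\<integral>w. 1 \<partial>?W) = (1::complex)"
      by (simp only: lebesgue_integral_const W.prob_space scaleR_one)
    ultimately show ?thesis by (simp only:)
  qed
  have eps_int: "integrable M (\<epsilon> n)" if "n \<ge> 1" for n
    using signs_law_and_mean(3)[of M "\<epsilon> n" 0] eps[OF that] assms(1,4,5) that by simp
  have T_eps: "AE y in N. T (\<lambda>x. complex_of_real (\<epsilon> n x)) y = complex_of_real (d n y)"
    if n: "n \<ge> 1" for n
  proof -
    have comp: "(\<lambda>s. complex_of_real (s n)) \<in> borel_measurable ?S"
    proof -
      have "(\<lambda>s. s n) \<in> measurable ?S borel" using n by (intro measurable_component_singleton) simp
      moreover have "complex_of_real \<in> borel_measurable borel"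
        by (intro borel_measurable_continuous_onI continuous_intros)
      ultimately show ?thesis by (rule measurable_compose)
    qed
    have "AE y in N. T (\<lambda>x. complex_of_real (X x n)) y = (\<integral>w. complex_of_real (coins d (y, w) n) \<partial>?W)"
      using eps_int[OF n] n by (intro T_fun[rule_format] comp) (simp add: X_def)
    then show ?thesis
      using assms(11)[of n]
    proof eventually_elim
      case (elim y)
      have "(\<integral>w. coins d (y, w) n \<partial>?W) = (\<integral>w. coin (d n y) (w n) \<partial>?W)"
        using n by (simp add: coins_def)
      also have "\<dots> = (\<integral>t. coin (d n y) t \<partial>distr ?W unit_uniform (\<lambda>w. w n))"
        using n by (intro integral_distr[symmetric] measurable_component_singleton) simp_all
      also have "\<dots> = d n y"
        using n elim(2) by (subst U.PiM_component) (simp_all add: coin_mean)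
      finally show ?case using elim(1) n by (simp add: X_def)
    qed
  qed
  show ?thesis
  proof (intro conjI)
    \<comment> \<open>Taking real parts keeps the contraction and gives the operator on real functions.\<close>
    define R where "R f y = Re (T (\<lambda>x. complex_of_real (f x)) y)" for f :: "'a \<Rightarrow> real" and y
    have R_int: "integrable N (R f)" if "integrable M f" for f
      unfolding R_def using T_int[of "\<lambda>x. complex_of_real (f x)"] that by simp
    have R_add: "AE y in N. R (\<lambda>x. f x + g x) y = R f y + R g y"
      if "integrable M f" "integrable M g" for f g
      using L1_contractionD(2)[OF T, of "\<lambda>x. complex_of_real (f x)" "\<lambda>x. complex_of_real (g x)"] that
      by (simp add: R_def) (auto elim!: eventually_mono)
    have R_scale: "AE y in N. R (\<lambda>x. c * f x) y = c * R f y" if "integrable M f" for c f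
      using L1_contractionD(3)[OF T, of "\<lambda>x. complex_of_real (f x)" "complex_of_real c"] that
      by (simp add: R_def) (auto elim!: eventually_mono)
    have R_norm: "(\<integral>y. norm (R f y) \<partial>N) \<le> (\<integral>x. norm (f x) \<partial>M)" if f: "integrable M f" for f
    proof -
      have "(\<integral>y. norm (R f y) \<partial>N) \<le> (\<integral>y. norm (T (\<lambda>x. complex_of_real (f x)) y) \<partial>N)"
        using f by (intro integral_mono integrable_norm R_int T_int) (auto simp: R_def abs_Re_le_cmod)
      also have "\<dots> \<le> (\<integral>x. norm (f x) \<partial>M)" using L1_contractionD(4)[OF T, of "\<lambda>x. complex_of_real (f x)"] f by simp
      finally show ?thesis .
    qed
    have R_one: "AE y in N. R (\<lambda>_. 1) y = 1"
      using T_one by (auto simp: R_def elim!: eventually_mono)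
    have R_eps: "AE y in N. R (\<epsilon> n) y = d n y" if "n \<ge> 1" for n
      using T_eps[OF that] by (auto simp: R_def elim!: eventually_mono)
    have d_int: "integrable N (d n)" for n
      using assms(11)[of n] by (intro N.integrable_const_bound[of _ 1] d) simp
    show "\<exists>u :: ('a \<Rightarrow> real) set \<Rightarrow> ('b \<Rightarrow> real) set.
            L1_linear M N u \<and> L1_opnorm M N u = 1 \<and>
            u (L1_class M (\<lambda>_. 1)) = L1_class N (\<lambda>_. 1) \<and>
            (\<forall>n\<ge>1. u (L1_class M (\<epsilon> n)) = L1_class N (d n))"
    proof -
      have R: "L1_contraction M N R"
        unfolding L1_contraction_def by (intro conjI allI impI R_int R_add R_scale R_norm)
      obtain u where u: "L1_linear M N u" "L1_opnorm M N u = 1"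
        "\<forall>f. integrable M f \<longrightarrow> u (L1_class M f) = L1_class N (R f)"
        by (rule L1_operator_of_functions[OF assms(1,2) R R_one])
      moreover have "L1_class N (R (\<lambda>_. 1)) = L1_class N (\<lambda>_. 1)"
        using R_one R_int by (subst L1_class_eq_iff) auto
      moreover have "L1_class N (R (\<epsilon> n)) = L1_class N (d n)" if "n \<ge> 1" for n
        using R_eps[OF that] R_int[OF eps_int[OF that]] d_int[of n]
        by (subst L1_class_eq_iff) auto
      ultimately show ?thesis using eps_int by (intro exI[of _ u]) auto
    qed
    show "\<exists>u :: ('a \<Rightarrow> complex) set \<Rightarrow> ('b \<Rightarrow> complex) set.
            L1_linear M N u \<and> L1_opnorm M N u = 1 \<and>
            u (L1_class M (\<lambda>_. 1)) = L1_class N (\<lambda>_. 1) \<and>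
            (\<forall>n\<ge>1. u (L1_class M (\<lambda>\<omega>. complex_of_real (\<epsilon> n \<omega>))) =
                     L1_class N (\<lambda>\<omega>. complex_of_real (d n \<omega>)))"
    proof -
      obtain u where u: "L1_linear M N u" "L1_opnorm M N u = 1"
        "\<forall>f. integrable M f \<longrightarrow> u (L1_class M f) = L1_class N (T f)"
        by (rule L1_operator_of_functions[OF assms(1,2) T T_one])
      moreover have "L1_class N (T (\<lambda>_. 1)) = L1_class N (\<lambda>_. 1)"
        using T_one T_int by (subst L1_class_eq_iff) auto
      moreover have "L1_class N (T (\<lambda>x. complex_of_real (\<epsilon> n x))) = L1_class N (\<lambda>y. complex_of_real (d n y))"
        if "n \<ge> 1" for n
        using T_eps[OF that] T_int[of "\<lambda>x. complex_of_real (\<epsilon> n x)"] eps_int[OF that] d_int[of n]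
        by (subst L1_class_eq_iff) auto
      ultimately show ?thesis using eps_int by (intro exI[of _ u]) auto
    qed
  qed
qed

end
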